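(* Let $\tilde W:\mathbf{R}^d\to\mathbf{R}$ be a $\mathrm{C}^1$ convex function satisfying $\tilde W(-x)=\tilde W(x)$ for any $x\in\mathbf{R}^d$, let $W(x,y)=\tilde W(x-y)$, and let $\mathcal{W}(\mu):=\frac12\int\int W(x,y)\,\mathrm{d}\mu(x)\,\mathrm{d}\mu(y)$ for $\mu\in\mathcal{P}_2(\mathbf{R}^d)$. Then $\mathcal{W}$ is transport convex, where the gradient of $\mathcal{W}$ is $\mathcal{G}_{\mathcal{W}}[\mu](x)=\int\nabla_1W(x,y)\,\mathrm{d}\mu(y)$.
   Context: $\mathcal{P}_2(\mathbf{R}^d)$ is the set of probability measures on $\mathbf{R}^d$ with finite second-order moment; $F_\#\mu$ is the push-forward of $\mu$ by $F$; $\nabla_1$ is the gradient with respect to the first variable in $\mathbf{R}^d$; $L^2(\mathbf{R}^d\to\mathbf{R}^d)$ is the set of maps $\mathbf{R}^d\to\mathbf{R}^d$ that are square integrable with respect to the base measure $\mu$. Transport convex: a functional $\mathcal{F}:\mathcal{P}_2(\mathbf{R}^d)\to\mathbf{R}$ with gradient $\mathcal{G}_{\mathcal{F}}:\mathcal{P}_2(\mathbf{R}^d)\times\mathbf{R}^d\to\mathbf{R}^d$ is transport convex if $\mathcal{F}(T_\#\mu)-\mathcal{F}(S_\#\mu)\ge\int\langle\mathcal{G}_{\mathcal{F}}[S_\#\mu](S(x)),T(x)-S(x)\rangle\,\mathrm{d}\mu(x)$ for any $S,T\in L^2(\mathbf{R}^d\to\mathbf{R}^d)$ and $\mu\in\mathcal{P}_2(\mathbf{R}^d)$.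 (Functionals are understood to be real-valued on $\mathcal{P}_2(\mathbf{R}^d)$.) *)

theory Defs
  imports "HOL-Probability.Probability"
begin

definition P2 :: "'a::euclidean_space measure set" where
  "P2 = {\<mu>. prob_space \<mu> \<and> sets \<mu> = sets borel \<and> integrable \<mu> (\<lambda>x. (norm x)\<^sup>2)}"

definition L2 :: "'a::euclidean_space measure \<Rightarrow> ('a \<Rightarrow> 'a) set" where
  "L2 \<mu> = {F \<in> borel_measurable \<mu>. integrable \<mu> (\<lambda>x. (norm (F x))\<^sup>2)}"

text \<open>A functional is a function on all measures of which only the values on \<open>P2\<close> matter. The
  integrability conjunct says that the integral in the inequality exists; the Bochner integral
  of a non-integrable function is 0 by convention.\<close>

definition transport_convex ::
  "('a::euclidean_space measure \<Rightarrow> real) \<Rightarrow> ('a measure \<Rightarrow> 'a \<Rightarrow> 'a) \<Rightarrow> bool" where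
  "transport_convex F G \<longleftrightarrow>
    (\<forall>\<mu>\<in>P2. \<forall>S\<in>L2 \<mu>. \<forall>T\<in>L2 \<mu>.
       integrable \<mu> (\<lambda>x. G (distr \<mu> borel S) (S x) \<bullet> (T x - S x)) \<and>
       F (distr \<mu> borel T) - F (distr \<mu> borel S)
         \<ge> (\<integral>x. G (distr \<mu> borel S) (S x) \<bullet> (T x - S x) \<partial>\<mu>))"

definition grad :: "('a::real_inner \<Rightarrow> real) \<Rightarrow> 'a \<Rightarrow> 'a" where
  "grad f x = (THE D. GDERIV f x :> D)"

lemma grad_eqI:
  assumes "GDERIV f x :> D"
  shows "grad f x = D"
  unfolding grad_def
proof (rule the_equality)
  show "GDERIV f x :> D" by fact
next
  fix D' assume "GDERIV f x :> D'"
  then have "(\<lambda>h. h \<bullet> D') = (\<lambda>h. h \<bullet> D)"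
    using assms unfolding gderiv_def by (rule has_derivative_unique)
  then show "D' = D"
    by (metis inner_commute vector_eq_rdot)
qed

definition C1 :: "('a::real_inner \<Rightarrow> real) \<Rightarrow> bool" where
  "C1 f \<longleftrightarrow> (\<exists>g. (\<forall>x. GDERIV f x :> g x) \<and> continuous_on UNIV g)"

definition interaction_energy ::
  "('a::euclidean_space \<Rightarrow> 'a \<Rightarrow> real) \<Rightarrow> 'a measure \<Rightarrow> real" where
  "interaction_energy W \<mu> = 1 / 2 * (\<integral>y. (\<integral>x. W x y \<partial>\<mu>) \<partial>\<mu>)"

definition interaction_gradient ::
  "('a::euclidean_space \<Rightarrow> 'a \<Rightarrow> real) \<Rightarrow> 'a measure \<Rightarrow> 'a \<Rightarrow> 'a" where
  "interaction_gradient W \<mu> x = (\<integral>y. grad (\<lambda>u. W u y) x \<partial>\<mu>)"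

text \<open>The double integral above is a finite real number on all of \<open>P2\<close>, so that
  \<open>interaction_energy W\<close> is a real-valued functional there. This excludes kernels that grow
  too fast, for which the energy is infinite for some measures in \<open>P2\<close>.\<close>

definition finite_interaction :: "('a::euclidean_space \<Rightarrow> 'a \<Rightarrow> real) \<Rightarrow> bool" where
  "finite_interaction W \<longleftrightarrow> (\<forall>\<mu>\<in>P2. integrable (\<mu> \<Otimes>\<^sub>M \<mu>) (\<lambda>(x, y). W x y))"

end

theory Submission
  imports Defs
begin

text \<open>Integrability comes from finiteness of the energy of mixtures: the energy of
  \<open>(\<mu> + \<nu>) / 2\<close> contains the cross term \<open>\<integral>\<integral>W \<partial>\<mu> \<partial>\<nu>\<close>, so \<open>W\<close> is integrable for every product of two
  measures in \<open>P2\<close>, and convexity bounds \<open>\<bar>g a \<bullet> h\<bar>\<close>, where \<open>g\<close> is the gradient of \<open>Wt\<close>, by values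
  of \<open>Wt\<close> at \<open>a\<close> and \<open>a \<plusminus> h\<close>. Since \<open>g\<close> is odd, symmetrizing
  \<open>\<integral>\<integral>g (S x - S y) \<bullet> (T x - S x)\<close> in \<open>x\<close> and \<open>y\<close> turns it into half the integral of
  \<open>g (S x - S y) \<bullet> ((T x - T y) - (S x - S y))\<close>, to which the tangent inequality applies.\<close>

section \<open>Mixtures in \<open>P2\<close> and integrability over products of two measures\<close>

lemma P2_mixture:
  fixes \<mu> \<nu> :: "'a::euclidean_space measure"
  assumes "\<mu> \<in> P2" "\<nu> \<in> P2"
  obtains \<rho> where "\<rho> \<in> P2"
    and "\<And>f. f \<in> borel_measurable borel \<Longrightarrow>
      (\<integral>\<^sup>+x. f x \<partial>\<rho>) = (\<integral>\<^sup>+x. f x \<partial>\<mu>) / 2 + (\<integral>\<^sup>+x. f x \<partial>\<nu>) / 2"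
proof -
  \<comment> \<open>A fair coin chooses which of the two measures to sample from, so
    \<open>\<rho>\<close> is the half-half mixture.\<close>
  define N where "N = (\<lambda>c. if c then \<mu> else \<nu>)"
  define \<rho> where "\<rho> = measure_pmf (bernoulli_pmf (1/2)) \<bind> N"
  have ps: "prob_space \<mu>" "prob_space \<nu>" and s: "sets \<mu> = sets borel" "sets \<nu> = sets borel"
    and i: "integrable \<mu> (\<lambda>x. (norm x)\<^sup>2)" "integrable \<nu> (\<lambda>x. (norm x)\<^sup>2)"
    using assms by (auto simp: P2_def)
  have N: "N \<in> measurable (measure_pmf (bernoulli_pmf (1/2))) (subprob_algebra borel)"
    using ps s by (auto simp: N_def space_subprob_algebra intro: prob_space_imp_subprob_space split: if_splits)
  have sr: "sets \<rho> = sets borel"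
    unfolding \<rho>_def using s by (intro sets_bind) (auto simp: N_def)
  \<comment> \<open>Nonnegative integrals may be infinite, so the formula can be used before any
    integrability is known; total mass and second moment of \<open>\<rho>\<close> are read off from
    it.\<close>
  have nn: "(\<integral>\<^sup>+x. f x \<partial>\<rho>) = (\<integral>\<^sup>+x. f x \<partial>\<mu>) / 2 + (\<integral>\<^sup>+x. f x \<partial>\<nu>) / 2"
    if f: "f \<in> borel_measurable borel" for f
  proof -
    have "ennreal (1/2) = inverse 2"
      by (simp add: inverse_eq_divide divide_ennreal_def flip: ennreal_numeral inverse_ennreal)
    then show ?thesis
      unfolding \<rho>_def nn_integral_bind[OF f N]
      by (simp add: N_def divide_ennreal_def)
  qed
  have "emeasure \<rho> (space \<rho>) = 1"
    using nn[of "\<lambda>_. 1"] prob_space.emeasure_space_1[OF ps(1)] prob_space.emeasure_space_1[OF ps(2)]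
    by (simp add: ennreal_divide_self flip: add_divide_distrib_ennreal)
  then have "prob_space \<rho>" by (rule prob_spaceI)
  moreover have "integrable \<rho> (\<lambda>x. (norm x)\<^sup>2)"
  proof -
    have "(\<lambda>x::'a. (norm x)\<^sup>2) \<in> borel_measurable \<rho>"
      by (subst measurable_cong_sets[OF sr refl]) measurable
    moreover have "(\<integral>\<^sup>+x. ennreal (norm ((norm x)\<^sup>2)) \<partial>\<rho>) < \<infinity>"
      using i by (subst nn) (auto simp: integrable_iff_bounded ennreal_divide_eq_top_iff simp flip: less_top)
    ultimately show ?thesis by (simp add: integrable_iff_bounded)
  qed
  ultimately have "\<rho> \<in> P2" using sr by (simp add: P2_def)
  then show thesis using nn that by blast
qed

lemma finite_interaction_integrable_pair:
  fixes \<mu> \<nu> :: "'a::euclidean_space measure"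
  assumes fin: "finite_interaction W" and W: "(\<lambda>(x, y). W x y) \<in> borel_measurable borel"
    and "\<mu> \<in> P2" "\<nu> \<in> P2"
  shows "integrable (\<mu> \<Otimes>\<^sub>M \<nu>) (\<lambda>(x, y). W x y)"
proof -
  obtain \<rho> where \<rho>: "\<rho> \<in> P2" and nn: "\<And>f. f \<in> borel_measurable borel \<Longrightarrow>
      (\<integral>\<^sup>+x. f x \<partial>\<rho>) = (\<integral>\<^sup>+x. f x \<partial>\<mu>) / 2 + (\<integral>\<^sup>+x. f x \<partial>\<nu>) / 2"
    using P2_mixture assms(3,4) by metis
  interpret r: prob_space \<rho> using \<rho> by (simp add: P2_def)
  interpret n: prob_space \<nu> using assms by (simp add: P2_def)
  have s [measurable_cong]: "sets \<rho> = sets borel" "sets \<nu> = sets borel" "sets \<mu> = sets borel"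
    using \<rho> assms by (auto simp: P2_def)
  have [measurable]: "(\<lambda>(x, y). W x y) \<in> borel_measurable (borel \<Otimes>\<^sub>M borel)"
    using W by (simp add: borel_prod)
  define V where "V = (\<lambda>\<eta> x. \<integral>\<^sup>+y. ennreal (norm (W x y)) \<partial>\<eta>)"
  have [measurable]: "V \<nu> \<in> borel_measurable borel" "V \<rho> \<in> borel_measurable borel"
    unfolding V_def by measurable
  \<comment> \<open>One half comes from keeping only the \<open>\<mu>\<close> share of
    \<open>\<rho>\<close> in the outer variable, the other from keeping only its
    \<open>\<nu>\<close> share in the inner one. The integrand is nonnegative, so a quarter of the
    cross term is at most the full double integral over \<open>\<rho>\<close>.\<close>
  have "(\<integral>\<^sup>+x. V \<nu> x \<partial>\<mu>) / 2 / 2 = (\<integral>\<^sup>+x. V \<nu> x / 2 \<partial>\<mu>) / 2"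
    by (subst nn_integral_divide) auto
  also have "\<dots> \<le> (\<integral>\<^sup>+x. V \<nu> x / 2 \<partial>\<mu>) / 2 + (\<integral>\<^sup>+x. V \<nu> x / 2 \<partial>\<nu>) / 2"
    by simp
  also have "\<dots> = (\<integral>\<^sup>+x. V \<nu> x / 2 \<partial>\<rho>)"
    by (intro nn[symmetric]) measurable
  also have "\<dots> \<le> (\<integral>\<^sup>+x. V \<rho> x \<partial>\<rho>)"
    unfolding V_def by (intro nn_integral_mono) (subst nn, measurable)
  also have "\<dots> = (\<integral>\<^sup>+p. ennreal (norm (case p of (x, y) \<Rightarrow> W x y)) \<partial>(\<rho> \<Otimes>\<^sub>M \<rho>))"
    unfolding V_def by (subst r.nn_integral_fst[symmetric]) auto
  also have "\<dots> < \<infinity>"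
    using fin \<rho> by (auto simp: finite_interaction_def integrable_iff_bounded)
  finally have "(\<integral>\<^sup>+x. V \<nu> x \<partial>\<mu>) < \<infinity>"
    by (simp add: ennreal_divide_eq_top_iff flip: less_top)
  also have "(\<integral>\<^sup>+x. V \<nu> x \<partial>\<mu>) = (\<integral>\<^sup>+p. ennreal (norm (case p of (x, y) \<Rightarrow> W x y)) \<partial>(\<mu> \<Otimes>\<^sub>M \<nu>))"
    unfolding V_def by (subst n.nn_integral_fst[symmetric]) auto
  finally have "(\<integral>\<^sup>+p. ennreal (norm (case p of (x, y) \<Rightarrow> W x y)) \<partial>(\<mu> \<Otimes>\<^sub>M \<nu>)) < \<infinity>" .
  then show ?thesis by (simp add: integrable_iff_bounded)
qed

section \<open>Stability of \<open>P2\<close> under push-forward and of \<open>L2\<close> under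
  differences\<close>

lemma distr_in_P2:
  assumes "\<mu> \<in> P2" "S \<in> L2 \<mu>"
  shows "distr \<mu> borel S \<in> P2"
  using assms by (auto simp: P2_def L2_def integrable_distr_eq prob_space.prob_space_distr)

lemma diff_in_L2:
  assumes "\<mu> \<in> P2" "S \<in> L2 \<mu>" "T \<in> L2 \<mu>"
  shows "(\<lambda>x. S x - T x) \<in> L2 \<mu>"
proof -
  have [measurable]: "S \<in> borel_measurable \<mu>" "T \<in> borel_measurable \<mu>"
    and "integrable \<mu> (\<lambda>x. 2 * (norm (S x))\<^sup>2 + 2 * (norm (T x))\<^sup>2)"
    using assms by (auto simp: L2_def)
  moreover have "(norm (S x - T x))\<^sup>2 \<le> 2 * (norm (S x))\<^sup>2 + 2 * (norm (T x))\<^sup>2" for x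
  proof -
    \<comment> \<open>By the parallelogram law this square is exactly the gap in the
      inequality.\<close>
    have "0 \<le> (norm (S x + T x))\<^sup>2" by simp
    then show ?thesis by (simp add: power2_norm_eq_inner algebra_simps inner_commute)
  qed
  ultimately have "integrable \<mu> (\<lambda>x. (norm (S x - T x))\<^sup>2)"
    by (elim Bochner_Integration.integrable_bound) (auto intro!: AE_I2)
  then show ?thesis by (simp add: L2_def)
qed

section \<open>Gradients of convex and of even functions\<close>

lemma convex_on_above_gradient:
  assumes "convex_on UNIV f" "GDERIV f a :> D"
  shows "f a + D \<bullet> h \<le> f (a + h)"
proof -
  \<comment> \<open>Restriction to the line through \<open>a\<close> in direction \<open>h\<close>
    reduces the claim to the tangent inequality for convex functions of one real variable, between 0
    and 1.\<close>
  define u where "u = (\<lambda>t. f (a + t *\<^sub>R h))"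
  have "convex_on UNIV u"
    unfolding u_def
  proof (intro convex_onI)
    fix t x y :: real assume "0 < t" "t < 1"
    moreover have "a + ((1 - t) *\<^sub>R x + t *\<^sub>R y) *\<^sub>R h = (1 - t) *\<^sub>R (a + x *\<^sub>R h) + t *\<^sub>R (a + y *\<^sub>R h)"
      by (simp add: algebra_simps)
    ultimately show "f (a + ((1 - t) *\<^sub>R x + t *\<^sub>R y) *\<^sub>R h)
        \<le> (1 - t) * f (a + x *\<^sub>R h) + t * f (a + y *\<^sub>R h)"
      using convex_onD[OF assms(1), of t] by simp
  qed simp
  moreover have "(u has_real_derivative (D \<bullet> h)) (at 0)"
  proof -
    have "(f has_derivative (\<lambda>h. h \<bullet> D)) (at (a + 0 *\<^sub>R h))"
      using assms(2) by (simp add: gderiv_def)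
    then have "((\<lambda>t. f (a + t *\<^sub>R h)) has_derivative (\<lambda>t. (t *\<^sub>R h) \<bullet> D)) (at 0)"
      by (rule has_derivative_compose[rotated]) (auto intro!: derivative_eq_intros)
    then show ?thesis
      by (simp add: u_def has_field_derivative_def inner_commute mult.commute[of _ "D \<bullet> h"] fun_eq_iff)
  qed
  ultimately have "u 1 - u 0 \<ge> (D \<bullet> h) * (1 - 0)"
    by (intro convex_on_imp_above_tangent[of UNIV]) auto
  then show ?thesis by (simp add: u_def)
qed

text \<open>The tangent inequality for \<open>h\<close> bounds \<open>D \<bullet> h\<close> from
  above, the one for \<open>- h\<close> bounds it from below. Integrability of gradient terms is
  thereby reduced to that of \<open>f\<close> at shifted points.\<close>

lemma convex_on_abs_inner_gradient_le:
  assumes "convex_on UNIV f" "GDERIV f a :> D"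
  shows "\<bar>D \<bullet> h\<bar> \<le> \<bar>f (a + h)\<bar> + \<bar>f (a - h)\<bar> + \<bar>f a\<bar>"
  using convex_on_above_gradient[OF assms, of h] convex_on_above_gradient[OF assms, of "- h"]
  by simp

lemma GDERIV_even_odd:
  assumes "\<And>x. f (- x) = f x" "GDERIV f x :> D" "GDERIV f (- x) :> E"
  shows "E = - D"
proof -
  have "((\<lambda>x. f (- x)) has_derivative (\<lambda>h. (- h) \<bullet> E)) (at x)"
    by (rule has_derivative_compose[where f = uminus and g = f, OF _ assms(3)[unfolded gderiv_def]])
      (auto intro!: derivative_eq_intros)
  then have "GDERIV f x :> - E"
    using assms(1) by (simp add: gderiv_def)
  \<comment> \<open>Uniqueness of gradients: both sides equal \<open>grad f x\<close>.\<close>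
  then have "- E = D"
    using assms(2) grad_eqI by metis
  then show ?thesis by auto
qed

lemma GDERIV_shift:
  assumes "GDERIV f (x - y) :> D"
  shows "GDERIV (\<lambda>u. f (u - y)) x :> D"
  unfolding gderiv_def
  by (rule has_derivative_compose[where f = "\<lambda>u. u - y" and g = f, OF _ assms[unfolded gderiv_def]])
    (auto intro!: derivative_eq_intros)

section \<open>Transport convexity of the interaction energy\<close>

theorem theorem4p4:
  fixes Wt :: "'a::euclidean_space \<Rightarrow> real" and W :: "'a \<Rightarrow> 'a \<Rightarrow> real"
  assumes "C1 Wt"
    and "convex_on UNIV Wt"
    and "\<And>x. Wt (- x) = Wt x"
    and "\<And>x y. W x y = Wt (x - y)"
    and "finite_interaction W"
  shows "(\<forall>\<mu>\<in>P2. \<forall>x. integrable \<mu> (\<lambda>y. grad (\<lambda>u. W u y) x)) \<and>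
    transport_convex (interaction_energy W) (interaction_gradient W)"
proof -
  obtain g where g: "\<And>x. GDERIV Wt x :> g x" and cg: "continuous_on UNIV g"
    using assms(1) by (auto simp: C1_def)
  have [measurable]: "g \<in> borel_measurable borel"
    using cg by (rule borel_measurable_continuous_onI)
  have "continuous_on UNIV Wt"
    using g unfolding gderiv_def by (metis continuous_at_imp_continuous_on has_derivative_continuous)
  then have [measurable]: "Wt \<in> borel_measurable borel"
    by (rule borel_measurable_continuous_onI)
  have Wm: "(\<lambda>(x, y). W x y) \<in> borel_measurable borel"
    unfolding assms(4) borel_prod[symmetric] by measurable
  have godd: "g (- x) = - g x" for x
    using GDERIV_even_odd[OF assms(3) g g] .
  have gW: "grad (\<lambda>u. W u y) x = g (x - y)" for x y
    unfolding assms(4) by (intro grad_eqI GDERIV_shift g)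
  note tangent = convex_on_above_gradient[OF assms(2) g]
  note abs_le = convex_on_abs_inner_gradient_le[OF assms(2) g]
  \<comment> \<open>Two different maps are allowed because mixed terms such as
    \<open>Wt (T x - S y)\<close> occur in the bound on the gradient kernel; the two push-forwards
    are then different measures in \<open>P2\<close>.\<close>
  have pair: "integrable (\<mu> \<Otimes>\<^sub>M \<mu>) (\<lambda>(x, y). Wt (A x - B y))"
    if \<mu>: "\<mu> \<in> P2" and A: "A \<in> L2 \<mu>" and B: "B \<in> L2 \<mu>" for \<mu> A B
  proof -
    interpret m: prob_space \<mu> using \<mu> by (simp add: P2_def)
    have [measurable]: "A \<in> borel_measurable \<mu>" "B \<in> borel_measurable \<mu>"
      using A B by (auto simp: L2_def)
    interpret b: prob_space "distr \<mu> borel B" by (rule m.prob_space_distr) measurable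
    have "integrable (distr \<mu> borel A \<Otimes>\<^sub>M distr \<mu> borel B) (\<lambda>(x, y). W x y)"
      by (intro finite_interaction_integrable_pair assms(5) Wm distr_in_P2 \<mu> A B)
    also have "distr \<mu> borel A \<Otimes>\<^sub>M distr \<mu> borel B
        = distr (\<mu> \<Otimes>\<^sub>M \<mu>) (borel \<Otimes>\<^sub>M borel) (\<lambda>(x, y). (A x, B y))"
      by (intro pair_measure_distr) (measurable, unfold_locales)
    finally have "integrable (\<mu> \<Otimes>\<^sub>M \<mu>) (\<lambda>q. case (case q of (x, y) \<Rightarrow> (A x, B y)) of (x, y) \<Rightarrow> W x y)"
      by (rule integrable_distr[rotated]) measurable
    then show ?thesis by (simp add: assms(4) case_prod_unfold)
  qed
  have gint: "integrable \<mu> (\<lambda>y. g (x - y))" if \<mu>: "\<mu> \<in> P2" for \<mu> x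
  proof -
    interpret m: prob_space \<mu> using \<mu> by (simp add: P2_def)
    have s [measurable_cong]: "sets \<mu> = sets borel" using \<mu> by (simp add: P2_def)
    have Wint: "integrable \<mu> (\<lambda>y. Wt (z - y))" for z
    proof -
      \<comment> \<open>Pairing \<open>\<mu>\<close> with the Dirac mass at \<open>z\<close> gives
        integrability at this very point, where Fubini for a general measure would give it only
        almost everywhere.\<close>
      define \<delta> where "\<delta> = (return borel z :: 'a measure)"
      have sd [measurable_cong]: "sets \<delta> = sets borel" by (simp add: \<delta>_def)
      have "\<delta> \<in> P2"
        by (auto simp: \<delta>_def P2_def prob_space_return integrable_iff_bounded nn_integral_return)
      then have "integrable (\<delta> \<Otimes>\<^sub>M \<mu>) (\<lambda>(x, y). W x y)"
        by (intro finite_interaction_integrable_pair assms(5) Wm \<mu>)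
      then have "(\<integral>\<^sup>+p. ennreal (norm (Wt (fst p - snd p))) \<partial>(\<delta> \<Otimes>\<^sub>M \<mu>)) < \<infinity>"
        by (simp add: integrable_iff_bounded assms(4) case_prod_unfold)
      also have "(\<integral>\<^sup>+p. ennreal (norm (Wt (fst p - snd p))) \<partial>(\<delta> \<Otimes>\<^sub>M \<mu>))
          = (\<integral>\<^sup>+x. (\<integral>\<^sup>+y. ennreal (norm (Wt (x - y))) \<partial>\<mu>) \<partial>\<delta>)"
        by (subst m.nn_integral_fst[symmetric]) auto
      also have "\<dots> = (\<integral>\<^sup>+y. ennreal (norm (Wt (z - y))) \<partial>\<mu>)"
        unfolding \<delta>_def by (subst nn_integral_return) auto
      finally show ?thesis by (auto simp: integrable_iff_bounded)
    qed
    \<comment> \<open>The convexity bound controls \<open>g\<close> only in a fixed direction, so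
      the vector-valued integrand is treated one coordinate at a time.\<close>
    have "integrable \<mu> (\<lambda>y. (g (x - y) \<bullet> b) *\<^sub>R b)" for b
    proof -
      have "integrable \<mu> (\<lambda>y. g (x - y) \<bullet> b)"
      proof (rule Bochner_Integration.integrable_bound)
        show "integrable \<mu> (\<lambda>y. \<bar>Wt (x + b - y)\<bar> + \<bar>Wt (x - b - y)\<bar> + \<bar>Wt (x - y)\<bar>)"
          by (intro Bochner_Integration.integrable_add integrable_abs Wint)
        show "AE y in \<mu>. norm (g (x - y) \<bullet> b)
            \<le> norm (\<bar>Wt (x + b - y)\<bar> + \<bar>Wt (x - b - y)\<bar> + \<bar>Wt (x - y)\<bar>)"
          using abs_le[of "x - _" b] by (intro AE_I2) (simp add: algebra_simps)
      qed measurable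
      then show ?thesis by simp
    qed
    then have "integrable \<mu> (\<lambda>y. \<Sum>b\<in>Basis. (g (x - y) \<bullet> b) *\<^sub>R b)"
      by simp
    then show ?thesis by (simp add: euclidean_representation)
  qed
  have "transport_convex (interaction_energy W) (interaction_gradient W)"
    unfolding transport_convex_def
  proof (intro ballI)
    fix \<mu> :: "'a measure" and S T
    assume \<mu>: "\<mu> \<in> P2" and S: "S \<in> L2 \<mu>" and T: "T \<in> L2 \<mu>"
    interpret m: prob_space \<mu> using \<mu> by (simp add: P2_def)
    interpret p: pair_sigma_finite \<mu> \<mu> ..
    have s [measurable_cong]: "sets \<mu> = sets borel" using \<mu> by (simp add: P2_def)
    have [measurable]: "S \<in> borel_measurable \<mu>" "T \<in> borel_measurable \<mu>"
      using S T by (auto simp: L2_def)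
    define k where "k = (\<lambda>x y. g (S x - S y) \<bullet> (T x - S x))"
    have energy: "interaction_energy W (distr \<mu> borel A)
        = 1 / 2 * (\<integral>(x, y). Wt (A x - A y) \<partial>(\<mu> \<Otimes>\<^sub>M \<mu>))" if A: "A \<in> L2 \<mu>" for A
    proof -
      have [measurable]: "A \<in> borel_measurable \<mu>" using A by (auto simp: L2_def)
      have "interaction_energy W (distr \<mu> borel A) = 1 / 2 * (\<integral>y. (\<integral>x. Wt (A x - A y) \<partial>\<mu>) \<partial>\<mu>)"
        unfolding interaction_energy_def assms(4) by (simp add: integral_distr)
      then show ?thesis using p.integral_snd[OF pair[OF \<mu> A A]] by simp
    qed
    have kint: "integrable (\<mu> \<Otimes>\<^sub>M \<mu>) (\<lambda>(x, y). k x y)"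
    proof (rule Bochner_Integration.integrable_bound)
      \<comment> \<open>\<open>R\<close> is the reflection of \<open>T\<close> through
        \<open>S\<close>: with \<open>a = S x - S y\<close> and \<open>h = T x - S x\<close>, the
        points \<open>a + h\<close> and \<open>a - h\<close> are \<open>T x - S y\<close> and
        \<open>R x - S y\<close>.\<close>
      define R where "R = (\<lambda>x. S x - (T x - S x))"
      have R: "R \<in> L2 \<mu>"
        unfolding R_def by (intro diff_in_L2 \<mu> S T)
      show "integrable (\<mu> \<Otimes>\<^sub>M \<mu>) (\<lambda>q. \<bar>case q of (x, y) \<Rightarrow> Wt (T x - S y)\<bar>
          + \<bar>case q of (x, y) \<Rightarrow> Wt (R x - S y)\<bar> + \<bar>case q of (x, y) \<Rightarrow> Wt (S x - S y)\<bar>)"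
        by (intro Bochner_Integration.integrable_add integrable_abs pair \<mu> S T R)
      have "\<bar>k x y\<bar> \<le> \<bar>Wt (T x - S y)\<bar> + \<bar>Wt (R x - S y)\<bar> + \<bar>Wt (S x - S y)\<bar>" for x y
        using abs_le[of "S x - S y" "T x - S x"] by (simp add: k_def R_def algebra_simps)
      then show "AE q in \<mu> \<Otimes>\<^sub>M \<mu>. norm (case q of (x, y) \<Rightarrow> k x y)
          \<le> norm (\<bar>case q of (x, y) \<Rightarrow> Wt (T x - S y)\<bar>
            + \<bar>case q of (x, y) \<Rightarrow> Wt (R x - S y)\<bar> + \<bar>case q of (x, y) \<Rightarrow> Wt (S x - S y)\<bar>)"
        by (intro AE_I2) auto
    qed (unfold k_def, measurable)
    \<comment> \<open>Moving the inner product under the integral requires integrability of the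
      gradient kernel at the point \<open>S x\<close>, supplied for every \<open>x\<close> by
      \<open>gint\<close>.\<close>
    have G: "interaction_gradient W (distr \<mu> borel S) (S x) \<bullet> (T x - S x) = (\<integral>y. k x y \<partial>\<mu>)" for x
    proof -
      have "integrable (distr \<mu> borel S) (\<lambda>y. g (S x - y))"
        by (intro gint distr_in_P2 \<mu> S)
      then have "integrable \<mu> (\<lambda>y. g (S x - S y))"
        by (simp add: integrable_distr_eq)
      then show ?thesis
        by (simp add: interaction_gradient_def gW integral_distr k_def)
    qed
    have kswap: "integrable (\<mu> \<Otimes>\<^sub>M \<mu>) (\<lambda>(x, y). k y x)"
      using p.integrable_product_swap[OF kint] by (simp add: case_prod_beta)
    have "2 * (\<integral>(x, y). k x y \<partial>(\<mu> \<Otimes>\<^sub>M \<mu>))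
        = (\<integral>(x, y). k x y \<partial>(\<mu> \<Otimes>\<^sub>M \<mu>)) + (\<integral>(x, y). k y x \<partial>(\<mu> \<Otimes>\<^sub>M \<mu>))"
      using p.integral_product_swap[of "\<lambda>(x, y). k x y"] kint by (simp add: case_prod_beta)
    also have "\<dots> = (\<integral>q. (case q of (x, y) \<Rightarrow> k x y) + (case q of (x, y) \<Rightarrow> k y x) \<partial>(\<mu> \<Otimes>\<^sub>M \<mu>))"
      using kint kswap by simp
    also have "\<dots> \<le> (\<integral>q. (case q of (x, y) \<Rightarrow> Wt (T x - T y)) - (case q of (x, y) \<Rightarrow> Wt (S x - S y)) \<partial>(\<mu> \<Otimes>\<^sub>M \<mu>))"
    proof (intro integral_mono Bochner_Integration.integrable_add kint kswap
        Bochner_Integration.integrable_diff pair \<mu> S T)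
      \<comment> \<open>Oddness of \<open>g\<close> merges the left side into one inner product with
        \<open>g (S x - S y)\<close>; the increment it is paired with leads from
        \<open>S x - S y\<close> to \<open>T x - T y\<close>.\<close>
      have "k x y + k y x \<le> Wt (T x - T y) - Wt (S x - S y)" for x y
        using tangent[of "S x - S y" "(T x - S x) - (T y - S y)"] godd[of "S x - S y"]
        by (simp add: k_def inner_diff_right)
      then show "(case q of (x, y) \<Rightarrow> k x y) + (case q of (x, y) \<Rightarrow> k y x)
          \<le> (case q of (x, y) \<Rightarrow> Wt (T x - T y)) - (case q of (x, y) \<Rightarrow> Wt (S x - S y))" for q
        by (cases q) simp
    qed
    \<comment> \<open>The factor 2 offsets the 1/2 in the energy and matches the one from
      symmetrizing.\<close>
    also have "\<dots> = 2 * (interaction_energy W (distr \<mu> borel T) - interaction_energy W (distr \<mu> borel S))"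
      using pair[OF \<mu> T T] pair[OF \<mu> S S] by (subst Bochner_Integration.integral_diff) (auto simp: energy S T)
    \<comment> \<open>Fubini for \<open>k\<close> yields both the integrability in \<open>x\<close>
      and the passage from the product integral to the iterated one.\<close>
    finally show "integrable \<mu> (\<lambda>x. interaction_gradient W (distr \<mu> borel S) (S x) \<bullet> (T x - S x)) \<and>
        interaction_energy W (distr \<mu> borel T) - interaction_energy W (distr \<mu> borel S)
          \<ge> (\<integral>x. interaction_gradient W (distr \<mu> borel S) (S x) \<bullet> (T x - S x) \<partial>\<mu>)"
      using p.integrable_fst[OF kint] p.integral_fst[OF kint] by (simp add: G)
  qed
  then show ?thesis using gint by (simp add: gW)
qed

end
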